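(* Let $k\ge 3$ and let $\mathcal C$ be any geometric $(m_k)$ configuration with independent pencils of $p\ge 0$ and $q\ge 1$ parallel lines. Then for each integer $r$ with $1\le r\le p+q$, the affine switch construction (with suitable choices) applied to $\mathcal C$ produces a geometric $(n_k)$ configuration with $n=(k-1)m+r$.
   Context: A geometric $(n_k)$ configuration is a set of $n$ distinct points and $n$ distinct (straight) lines in the real Euclidean plane such that each of the points lies on exactly $k$ of the lines and each of the lines contains exactly $k$ of the points. A configuration has independent pencils of $p$ and $q$ parallel lines if it contains a set $\mathcal P$ of $p$ pairwise parallel lines in one direction and a set $\mathcal Q$ of $q$ pairwise parallel lines in a second, different direction such that no configuration point lies both on a line of $\mathcal P$ and on a line of $\mathcal Q$ (if $p=0$ then $\mathcal P$ is empty). The affine switch construction, applied to $\mathcal C$, is as follows. First apply an affine transformation to place $\mathcal C$ so that the lines of $\mathcal P$ are parallel to the $x$-axis and the lines of $\mathcal Q$ are parallel to the $y$-axis. (1) Remove $s$ lines of $\mathcal P$ and $t$ lines of $\mathcal Q$ ($0\le s\le p$, $0\le t\le q$, $s+t=r$) from $\mathcal C$, keeping all points; call the resulting structure $\widehat{\mathcal C}$. (2) Choose a positive integer $h$ and, for $j=1,\dots,k-2$, let $\alpha_j$ be the linear map with matrix $\mathrm{diag}\left(\frac{h-j}{h},\frac{h+j}{h}\right)$; form the images $\alpha_j(\widehat{\mathcal C})$. (3) For each point $P$ of $\widehat{\mathcal C}$ incident with a removed line, add the line containing the $k-1$ collinear points $P,\alpha_1(P),\dots,\alpha_{k-2}(P)$.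 (4) For each removed line $\ell$, the $k$ lines added in (3) for the $k$ configuration points $P\in\ell$ are concurrent in a point lying on the coordinate axis perpendicular to $\ell$; add this point. The result consists of all points and lines of $\widehat{\mathcal C},\alpha_1(\widehat{\mathcal C}),\dots,\alpha_{k-2}(\widehat{\mathcal C})$ together with the $rk$ new lines and the $r$ new points. *)

theory Defs
  imports "HOL-Analysis.Analysis"
begin

definition is_line :: "(real^2) set \<Rightarrow> bool" where
  "is_line l \<longleftrightarrow> affine l \<and> aff_dim l = 1"

(* The finiteness conditions are needed because card is 0 on infinite sets. *)
definition geometric_configuration ::
  "nat \<Rightarrow> nat \<Rightarrow> (real^2) set \<Rightarrow> (real^2) set set \<Rightarrow> bool" where
  "geometric_configuration n k X L \<longleftrightarrow>
     finite X \<and> card X = n \<and>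
     finite L \<and> card L = n \<and> (\<forall>l\<in>L. is_line l) \<and>
     (\<forall>x\<in>X. card {l\<in>L. x \<in> l} = k) \<and>
     (\<forall>l\<in>L. card {x\<in>X. x \<in> l} = k)"

definition independent_pencils ::
  "(real^2) set \<Rightarrow> (real^2) set set \<Rightarrow> nat \<Rightarrow> nat \<Rightarrow>
   (real^2) set set \<Rightarrow> (real^2) set set \<Rightarrow> bool" where
  "independent_pencils X L p q PP QQ \<longleftrightarrow>
     PP \<subseteq> L \<and> card PP = p \<and> pairwise affine_parallel PP \<and>
     QQ \<subseteq> L \<and> card QQ = q \<and> pairwise affine_parallel QQ \<and>
     (\<forall>l\<in>PP. \<forall>l'\<in>QQ. \<not> affine_parallel l l') \<and>
     \<not> (\<exists>x\<in>X. \<exists>l\<in>PP. \<exists>l'\<in>QQ. x \<in> l \<and> x \<in> l')"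

definition affine_transformation :: "(real^2 \<Rightarrow> real^2) \<Rightarrow> bool" where
  "affine_transformation f \<longleftrightarrow>
     (\<exists>(A::real^2^2) b. invertible A \<and> f = (\<lambda>v. A *v v + b))"

definition x_axis :: "(real^2) set" where
  "x_axis = {v. v $ 2 = 0}"

definition y_axis :: "(real^2) set" where
  "y_axis = {v. v $ 1 = 0}"

definition switch_map :: "nat \<Rightarrow> nat \<Rightarrow> real^2 \<Rightarrow> real^2" where
  "switch_map h j v =
     (vector [vector [(real h - real j) / real h, 0],
              vector [0, (real h + real j) / real h]] :: real^2^2) *v v"

(* The affine hull of P and its k - 2 images. It is a line unless these points all
   coincide. *)
definition switch_line :: "nat \<Rightarrow> nat \<Rightarrow> real^2 \<Rightarrow> (real^2) set" where
  "switch_line k h P = affine hull (insert P ((\<lambda>j. switch_map h j P) ` {1..k - 2}))"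

(* The common points on the given axis of the lines added for the removed line l. For a
   line l that is perpendicular to the axis and contains at least three points of X, there
   is at most one such point, namely the point of concurrency. *)
definition switch_centre ::
  "nat \<Rightarrow> nat \<Rightarrow> (real^2) set \<Rightarrow> (real^2) set \<Rightarrow> (real^2) set \<Rightarrow> (real^2) set" where
  "switch_centre k h X ax l = {c\<in>ax. \<forall>P\<in>X \<inter> l. c \<in> switch_line k h P}"

(* In the next two definitions (X, L) is already placed: S consists of the removed lines
   parallel to the x-axis and T of the removed lines parallel to the y-axis. *)
definition switch_points ::
  "nat \<Rightarrow> nat \<Rightarrow> (real^2) set \<Rightarrow> (real^2) set set \<Rightarrow> (real^2) set set \<Rightarrow> (real^2) set" where
  "switch_points k h X S T =
     X \<union> (\<Union>j\<in>{1..k - 2}. switch_map h j ` X) \<union>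
     (\<Union>l\<in>S. switch_centre k h X y_axis l) \<union>
     (\<Union>l\<in>T. switch_centre k h X x_axis l)"

definition switch_lines ::
  "nat \<Rightarrow> nat \<Rightarrow> (real^2) set \<Rightarrow> (real^2) set set \<Rightarrow> (real^2) set set \<Rightarrow> (real^2) set set \<Rightarrow>
   (real^2) set set" where
  "switch_lines k h X L S T =
     (L - (S \<union> T)) \<union> (\<Union>j\<in>{1..k - 2}. (\<lambda>l. switch_map h j ` l) ` (L - (S \<union> T))) \<union>
     switch_line k h ` {P\<in>X. \<exists>l\<in>S \<union> T. P \<in> l}"

(* (X', L') is the result of the construction applied to (X, L), for some choice of the
   placement f, of the removed lines S and T, and of h. *)
definition affine_switch ::
  "nat \<Rightarrow> nat \<Rightarrow> (real^2) set \<Rightarrow> (real^2) set set \<Rightarrow> (real^2) set set \<Rightarrow> (real^2) set set \<Rightarrow>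
   (real^2) set \<Rightarrow> (real^2) set set \<Rightarrow> bool" where
  "affine_switch k r X L PP QQ X' L' \<longleftrightarrow>
     (\<exists>f S T h. affine_transformation f \<and>
        (\<forall>l\<in>PP. affine_parallel (f ` l) x_axis) \<and>
        (\<forall>l\<in>QQ. affine_parallel (f ` l) y_axis) \<and>
        S \<subseteq> PP \<and> T \<subseteq> QQ \<and> card S + card T = r \<and> 0 < h \<and>
        X' = switch_points k h (f ` X) ((`) f ` S) ((`) f ` T) \<and>
        L' = switch_lines k h (f ` X) ((`) f ` L) ((`) f ` S) ((`) f ` T))"

end

theory Submission
  imports Defs
begin

text \<open>
  After the pencils have been made parallel to the axes, the copies of a point \<open>P = (x, y)\<close> are
  \<open>P + (j / h) (- x, y)\<close>. They lie on the line \<open>X / x + Y / y = 2\<close> (\<open>switch_line_eq\<close>), which meets the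
  axes in \<open>(0, 2 y)\<close> and \<open>(2 x, 0)\<close>. The first point is common to the lines added for all points
  on a removed horizontal line, and the second for all points on a removed vertical line
  (\<open>switch_centre_eq\<close>). By independence no point lies on two removed lines, so every point that
  loses a line gets exactly one new line back, and each new line carries \<open>k - 1\<close> copies and one
  centre. The counts are therefore correct as soon as there are no coincidences or
  incidences besides these.

  Unwanted incidences are avoided by the choice of the translational part \<open>b\<close> of
  the affine transformation, with \<open>h = k - 1\<close> fixed. Unless the coordinates of
  \<open>b\<close> are special, all points are off the axes, no point of a copy lies on a line
  of another copy, no centre lies on a copy of a line, and no switch line passes through a copy
  of a foreign point. Each exception is an equation in \<open>b\<close>, and each turns out to
  be an affine linear one that is not trivial. So it holds on a null set of translations only.
  Finitely many null sets do not cover the plane (\<open>exists_generic_translation\<close>).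
  Two nonempty pencils determine the linear part of the transformation up to scaling of the
  axes, so the translation is where the freedom lies.
\<close>

section \<open>Lines of the plane and the switch maps\<close>

lemma switch_map_component:
  "switch_map h j v $ 1 = (real h - real j) / real h * v $ 1"
  "switch_map h j v $ 2 = (real h + real j) / real h * v $ 2"
  by (simp_all add: switch_map_def matrix_vector_mult_def sum_2 vector_2)

lemma vec2_eqI: "v $ 1 = w $ 1 \<Longrightarrow> v $ 2 = w $ 2 \<Longrightarrow> v = (w :: real^2)"
  by (simp add: vec_eq_iff forall_2)

lemma switch_map_0: "0 < h \<Longrightarrow> switch_map h 0 v = v"
  by (rule vec2_eqI) (simp_all add: switch_map_component)

lemma linear_switch_map: "linear (switch_map h j)"
  unfolding switch_map_def by (rule matrix_vector_mul_linear)

lemma inj_switch_map: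
  assumes "j < h" shows "inj (switch_map h j)"
proof (rule injI)
  fix v w assume eq: "switch_map h j v = switch_map h j w"
  have "(real h - real j) / real h \<noteq> 0" "(real h + real j) / real h \<noteq> 0"
    using assms by auto
  with arg_cong[OF eq, of "\<lambda>u. u $ 1"] arg_cong[OF eq, of "\<lambda>u. u $ 2"]
  show "v = w" unfolding switch_map_component by (intro vec2_eqI) auto
qed

lemma is_line_iff:
  "is_line l \<longleftrightarrow> (\<exists>n c. n \<noteq> 0 \<and> l = {v. n \<bullet> v = c})"
proof
  assume "is_line l"
  then show "\<exists>n c. n \<noteq> 0 \<and> l = {v. n \<bullet> v = c}"
    using aff_dim_eq_hyperplane[of l] by (auto simp: is_line_def hull_same)
next
  assume "\<exists>n c. n \<noteq> 0 \<and> l = {v. n \<bullet> v = c}"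
  then show "is_line l"
    by (auto simp: is_line_def affine_hyperplane aff_dim_hyperplane)
qed

lemma is_line_injective_linear_image:
  assumes "linear g" "inj g" "is_line l" shows "is_line (g ` l)"
  using assms by (metis aff_dim_injective_linear_image affine_hull_eq affine_hull_linear_image
      is_line_def linear_conv_bounded_linear)

lemma is_line_translation: "is_line l \<Longrightarrow> is_line ((+) b ` l)"
  by (simp add: is_line_def affine_translation[symmetric] aff_dim_translation_eq)

text \<open>Parallel lines share their normal vector. In this form affine parallelism turns into a
  statement about equations, which is how the pencils are handled below.\<close>

lemma affine_parallel_hyperplane:
  fixes n :: "'a::euclidean_space"
  assumes "n \<noteq> 0"
  shows "affine_parallel {v. n \<bullet> v = c} l \<longleftrightarrow> (\<exists>d. l = {v. n \<bullet> v = d})"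
proof -
  have tr: "(\<lambda>x. a + x) ` {v. n \<bullet> v = c} = {v. n \<bullet> v = c + n \<bullet> a}" for a
  proof safe
    fix v assume "n \<bullet> v = c + n \<bullet> a"
    then show "v \<in> (+) a ` {v. n \<bullet> v = c}"
      by (intro image_eqI[of _ _ "v - a"]) (simp_all add: inner_diff_right)
  qed (simp add: inner_add_right)
  show ?thesis
  proof
    assume "\<exists>d. l = {v. n \<bullet> v = d}"
    then obtain d where d: "l = {v. n \<bullet> v = d}" ..
    have "(\<lambda>x. ((d - c) / (n \<bullet> n)) *\<^sub>R n + x) ` {v. n \<bullet> v = c} = l"
      unfolding tr d using assms by simp
    then show "affine_parallel {v. n \<bullet> v = c} l"
      unfolding affine_parallel_def by metis
  qed (auto simp: affine_parallel_def tr)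
qed

lemma affine_parallel_axis:
  "affine_parallel l x_axis \<longleftrightarrow> (\<exists>c. l = {v. v $ 2 = c})"
  "affine_parallel l y_axis \<longleftrightarrow> (\<exists>c. l = {v. v $ 1 = c})"
proof -
  have "x_axis = {v. axis 2 1 \<bullet> v = 0}" "y_axis = {v. axis 1 1 \<bullet> v = 0}"
    by (simp_all add: x_axis_def y_axis_def inner_axis')
  then show "affine_parallel l x_axis \<longleftrightarrow> (\<exists>c. l = {v. v $ 2 = c})"
     "affine_parallel l y_axis \<longleftrightarrow> (\<exists>c. l = {v. v $ 1 = c})"
    using affine_parallel_hyperplane[of "axis 2 1 :: real^2" 0 l]
      affine_parallel_hyperplane[of "axis 1 1 :: real^2" 0 l]
    by (simp_all add: inner_axis') (metis affine_parallel_commute)+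
qed

text \<open>For \<open>P = (x, y)\<close> the point \<open>switch_map h j P\<close> is \<open>P + (j / h) (- x, y)\<close>, so all of
  these points lie on the line \<open>X / x + Y / y = 2\<close>. Since \<open>k \<ge> 3\<close>, the images include that for
  \<open>j = 1\<close>, which differs from \<open>P\<close>; so they span this line.\<close>

lemma switch_line_eq:
  assumes "3 \<le> k" "0 < h" "P $ 1 \<noteq> 0" "P $ 2 \<noteq> 0"
  shows "switch_line k h P = {v. P $ 2 * v $ 1 + P $ 1 * v $ 2 = 2 * P $ 1 * P $ 2}"
    (is "_ = ?H")
proof
  have "affine ?H"
  proof -
    have "?H = {v. vector [P $ 2, P $ 1] \<bullet> v = 2 * P $ 1 * P $ 2}"
      by (simp add: inner_vec_def sum_2)
    then show ?thesis by (simp only: affine_hyperplane)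
  qed
  moreover have "insert P ((\<lambda>j. switch_map h j P) ` {1..k - 2}) \<subseteq> ?H"
    using assms(2) by (auto simp: switch_map_component field_simps)
  ultimately show "switch_line k h P \<subseteq> ?H"
    unfolding switch_line_def by (rule hull_minimal[rotated])
  show "?H \<subseteq> switch_line k h P"
  proof
    fix v assume "v \<in> ?H"
    then have v: "P $ 2 * v $ 1 + P $ 1 * v $ 2 = 2 * P $ 1 * P $ 2" by simp
    \<comment> \<open>the parameter of \<open>v\<close> on the line through \<open>P\<close> and its first image, read off
      from the second coordinate\<close>
    define s where "s = real h * (v $ 2 - P $ 2) / P $ 2"
    have "v = (1 - s) *\<^sub>R P + s *\<^sub>R switch_map h 1 P"
    proof (rule vec2_eqI)
      have "(v $ 1 - P $ 1) * P $ 2 = - (v $ 2 - P $ 2) * P $ 1"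
        using v by (simp add: algebra_simps)
      then have "v $ 1 - P $ 1 = - (v $ 2 - P $ 2) * P $ 1 / P $ 2"
        using assms(4) by (metis nonzero_mult_div_cancel_right)
      also have "\<dots> = - s / real h * P $ 1"
        using assms by (simp add: s_def field_simps)
      finally show "v $ 1 = ((1 - s) *\<^sub>R P + s *\<^sub>R switch_map h 1 P) $ 1"
        using assms(2) by (simp add: switch_map_component field_simps)
      show "v $ 2 = ((1 - s) *\<^sub>R P + s *\<^sub>R switch_map h 1 P) $ 2"
        using assms by (simp add: switch_map_component s_def field_simps)
    qed
    then have "v \<in> affine hull {P, switch_map h 1 P}"
      unfolding affine_hull_2 mem_Collect_eq by (intro exI[of _ "1 - s"] exI[of _ s]) simp
    also have "\<dots> \<subseteq> switch_line k h P"
      unfolding switch_line_def using assms(1) by (intro hull_mono) auto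
    finally show "v \<in> switch_line k h P" .
  qed
qed

section \<open>Generic translations\<close>

text \<open>The absence of every incidence that the switch construction does not intend. The last but one
  clause is about centres: the line added for \<open>P\<close> meets the axes in \<open>(0, 2 y)\<close> and \<open>(2 x, 0)\<close>, and
  one of these is the centre of the removed line through \<open>P\<close>. Both are kept off all images of
  lines, so that the condition does not mention which lines are removed. Distinctness of
  points and of lines follows from these clauses, because every line has a point and every
  point has a line.\<close>

definition generic_position ::
  "nat \<Rightarrow> nat \<Rightarrow> (real^2) set \<Rightarrow> (real^2) set set \<Rightarrow> bool" where
  "generic_position k h X L \<longleftrightarrow>
     (\<forall>P\<in>X. P $ 1 \<noteq> 0 \<and> P $ 2 \<noteq> 0) \<and>
     (\<forall>P\<in>X. \<forall>l\<in>L. \<forall>i\<in>{..k - 2}. \<forall>j\<in>{..k - 2}.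
        i \<noteq> j \<longrightarrow> switch_map h i P \<notin> switch_map h j ` l) \<and>
     (\<forall>P\<in>X. \<forall>l\<in>L. \<forall>j\<in>{..k - 2}.
        vector [0, 2 * P $ 2] \<notin> switch_map h j ` l \<and>
        vector [2 * P $ 1, 0] \<notin> switch_map h j ` l) \<and>
     (\<forall>P\<in>X. \<forall>Q\<in>X. \<forall>j\<in>{..k - 2}.
        P \<noteq> Q \<longrightarrow> switch_map h j Q \<notin> switch_line k h P)"

text \<open>A single forbidden incidence excludes the translation vectors on one line, a null set. Phrasing
  genericity by \<open>AE\<close> lets finitely many exclusions be combined by the rules for filters.\<close>

lemma AE_lborel_off_line:
  fixes A B c :: real
  assumes "A \<noteq> 0 \<or> B \<noteq> 0"
  shows "AE b in (lborel :: (real^2) measure). A * b $ 1 + B * b $ 2 \<noteq> c"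
proof -
  have "negligible {b. (vector [A, B] :: real^2) \<bullet> b = c}"
    using assms by (intro negligible_hyperplane) (metis vector_2 zero_index)
  then have "{b. (vector [A, B] :: real^2) \<bullet> b = c} \<in> null_sets lborel"
    by (simp add: negligible_iff_null_sets null_sets_completion_iff closed_hyperplane borel_closed)
  then show ?thesis
    by (auto simp: inner_vec_def sum_2 dest!: AE_not_in)
qed

lemma mem_switch_map_translated_line:
  assumes "j < h"
  shows "w \<in> switch_map h j ` (+) b ` {v. n \<bullet> v = c} \<longleftrightarrow>
    n $ 1 * (w $ 1 / ((real h - real j) / real h) - b $ 1) +
    n $ 2 * (w $ 2 / ((real h + real j) / real h) - b $ 2) = c"
proof -
  define s t where "s = (real h - real j) / real h" and "t = (real h + real j) / real h"
  have st: "s \<noteq> 0" "t \<noteq> 0" using assms by (auto simp: s_def t_def)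
  have "w \<in> switch_map h j ` (+) b ` {v. n \<bullet> v = c} \<longleftrightarrow>
     (\<exists>v::real^2. n $ 1 * v $ 1 + n $ 2 * v $ 2 = c \<and> w $ 1 = s * (b $ 1 + v $ 1) \<and> w $ 2 = t * (b $ 2 + v $ 2))"
    by (auto simp: image_iff vec_eq_iff forall_2 switch_map_component inner_vec_def sum_2 s_def t_def)
  also have "\<dots> \<longleftrightarrow> n $ 1 * (w $ 1 / s - b $ 1) + n $ 2 * (w $ 2 / t - b $ 2) = c"
  proof
    assume "n $ 1 * (w $ 1 / s - b $ 1) + n $ 2 * (w $ 2 / t - b $ 2) = c"
    then show "\<exists>v::real^2. n $ 1 * v $ 1 + n $ 2 * v $ 2 = c \<and> w $ 1 = s * (b $ 1 + v $ 1) \<and> w $ 2 = t * (b $ 2 + v $ 2)"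
      using st by (intro exI[of _ "vector [w $ 1 / s - b $ 1, w $ 2 / t - b $ 2]"]) simp
  qed (use st in auto)
  finally show ?thesis by (simp add: s_def t_def)
qed

text \<open>In the equation of the incidence, the coefficients of the coordinates of \<open>b\<close> are those of the
  normal vector of \<open>l\<close> times \<open>(h - i) / (h - j) - 1\<close> and \<open>(h + i) / (h + j) - 1\<close>. These factors are
  nonzero as \<open>i \<noteq> j\<close>, so the equation is that of a line.\<close>

lemma AE_translate_image_off_other_line:
  assumes "is_line l" "i < h" "j < h" "i \<noteq> j"
  shows "AE b in lborel. switch_map h i (b + P) \<notin> switch_map h j ` (+) b ` l"
proof -
  obtain n c where n: "n \<noteq> 0" and l: "l = {v. n \<bullet> v = c}"
    using assms(1) is_line_iff by auto
  define s t where "s i = (real h - real i) / real h" and "t i = (real h + real i) / real h" for i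
  have st: "s j \<noteq> 0" "t j \<noteq> 0" "s i / s j - 1 \<noteq> 0" "t i / t j - 1 \<noteq> 0"
    using assms by (auto simp: s_def t_def)
  have "n $ 1 \<noteq> 0 \<or> n $ 2 \<noteq> 0"
    using n vec2_eqI[of n 0] by auto
  then have "n $ 1 * (s i / s j - 1) \<noteq> 0 \<or> n $ 2 * (t i / t j - 1) \<noteq> 0"
    using st by auto
  from AE_lborel_off_line[OF this, of "c - n $ 1 * (s i / s j * P $ 1) - n $ 2 * (t i / t j * P $ 2)"]
  show ?thesis
    unfolding l mem_switch_map_translated_line[OF assms(3)] switch_map_component s_def[symmetric] t_def[symmetric]
    by eventually_elim (simp add: algebra_simps add_divide_distrib)
qed

text \<open>Again the incidence is an equation of a line for \<open>b\<close>: it is degenerate only if \<open>(h + j) / h\<close> or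
  \<open>(h - j) / h\<close> equals 2, which \<open>0 \<le> j < h\<close> excludes.\<close>

lemma AE_translate_centres_off_line:
  assumes "is_line l" "j < h"
  shows "AE b in lborel. vector [0, 2 * (b + P) $ 2] \<notin> switch_map h j ` (+) b ` l"
    and "AE b in lborel. vector [2 * (b + P) $ 1, 0] \<notin> switch_map h j ` (+) b ` l"
proof -
  obtain n c where n: "n \<noteq> 0" and l: "l = {v. n \<bullet> v = c}"
    using assms(1) is_line_iff by auto
  define s t where "s = (real h - real j) / real h" and "t = (real h + real j) / real h"
  have st: "s \<noteq> 0" "t \<noteq> 0" "2 / t - 1 \<noteq> 0" "2 / s - 1 \<noteq> 0"
    using assms(2) by (auto simp: s_def t_def field_simps)
  have nn: "n $ 1 \<noteq> 0 \<or> n $ 2 \<noteq> 0"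
    using n vec2_eqI[of n 0] by auto
  have "- n $ 1 \<noteq> 0 \<or> n $ 2 * (2 / t - 1) \<noteq> 0"
    using st nn by auto
  from AE_lborel_off_line[OF this, of "c - n $ 2 * (2 / t * P $ 2)"]
  show "AE b in lborel. vector [0, 2 * (b + P) $ 2] \<notin> switch_map h j ` (+) b ` l"
    unfolding l mem_switch_map_translated_line[OF assms(2)] s_def[symmetric] t_def[symmetric]
    by eventually_elim (simp add: algebra_simps add_divide_distrib)
  have "n $ 1 * (2 / s - 1) \<noteq> 0 \<or> - n $ 2 \<noteq> 0"
    using st nn by auto
  from AE_lborel_off_line[OF this, of "c - n $ 1 * (2 / s * P $ 1)"]
  show "AE b in lborel. vector [2 * (b + P) $ 1, 0] \<notin> switch_map h j ` (+) b ` l"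
    unfolding l mem_switch_map_translated_line[OF assms(2)] s_def[symmetric] t_def[symmetric]
    by eventually_elim (simp add: algebra_simps add_divide_distrib)
qed

lemma AE_translate_off_axes:
  fixes P :: "real^2"
  shows "AE b in lborel. (b + P) $ 1 \<noteq> 0 \<and> (b + P) $ 2 \<noteq> 0"
proof -
  have "AE b in (lborel :: (real^2) measure). 1 * b $ 1 + 0 * b $ 2 \<noteq> - P $ 1"
    "AE b in (lborel :: (real^2) measure). 0 * b $ 1 + 1 * b $ 2 \<noteq> - P $ 2"
    by (rule AE_lborel_off_line; simp)+
  then show ?thesis
    by eventually_elim (simp add: add_eq_0_iff2)
qed

text \<open>The incidence looks quadratic in \<open>b\<close>, because the line added for \<open>b + P\<close> depends on \<open>b\<close> too. But the
  two diagonal entries \<open>s\<close>, \<open>t\<close> of the switch map add up to 2, and this cancels the product of the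
  coordinates of \<open>b\<close>. The remaining coefficients \<open>t (Q - P)\<^sub>2\<close> and \<open>s (Q - P)\<^sub>1\<close> do not both vanish.\<close>

lemma AE_translate_image_off_switch_line:
  assumes "3 \<le> k" "j < h" "P \<noteq> Q"
  shows "AE b in lborel. switch_map h j (b + Q) \<notin> switch_line k h (b + P)"
proof -
  define s t where "s = (real h - real j) / real h" and "t = (real h + real j) / real h"
  have st: "s \<noteq> 0" "t \<noteq> 0" and s: "s = 2 - t"
    using assms(2) by (auto simp: s_def t_def field_simps)
  have "t * (Q $ 2 - P $ 2) \<noteq> 0 \<or> s * (Q $ 1 - P $ 1) \<noteq> 0"
    using assms(3) vec2_eqI[of P Q] st by auto
  from AE_lborel_off_line[OF this, of "2 * P $ 1 * P $ 2 - s * Q $ 1 * P $ 2 - t * Q $ 2 * P $ 1"]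
    AE_translate_off_axes[of P]
  show ?thesis
  proof eventually_elim
    case (elim b)
    have "switch_line k h (b + P) = {v. (b + P) $ 2 * v $ 1 + (b + P) $ 1 * v $ 2 = 2 * (b + P) $ 1 * (b + P) $ 2}"
      using elim assms by (intro switch_line_eq) auto
    then show ?case
      using elim(1) unfolding s by (auto simp: switch_map_component s_def[symmetric] t_def[symmetric] s algebra_simps)
  qed
qed

lemma exists_generic_translation:
  assumes "3 \<le> k" "k - 2 < h" "finite X" "finite L" "\<And>l. l \<in> L \<Longrightarrow> is_line l"
  obtains b where "generic_position k h ((+) b ` X) ((`) ((+) b) ` L)"
proof -
  have "AE b in lborel. generic_position k h ((+) b ` X) ((`) ((+) b) ` L)"
    unfolding generic_position_def ball_simps(9)
  proof (intro AE_conjI eventually_ball_finite ballI finite_atMost assms(3,4))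
    fix P assume "P \<in> X"
    show "AE b in lborel. (b + P) $ 1 \<noteq> 0" "AE b in lborel. (b + P) $ 2 \<noteq> 0"
      using AE_translate_off_axes[of P] by auto
    fix l i j assume "l \<in> L" "i \<in> {..k - 2}" "j \<in> {..k - 2}"
    then have "is_line l" "i < h" "j < h" using assms by auto
    then show "AE b in lborel. i \<noteq> j \<longrightarrow> switch_map h i (b + P) \<notin> switch_map h j ` (+) b ` l"
      by (intro AE_impI AE_translate_image_off_other_line)
  next
    fix P l j assume "l \<in> L" "j \<in> {..k - 2}"
    then have "is_line l" "j < h" using assms by auto
    then show "AE b in lborel. vector [0, 2 * (b + P) $ 2] \<notin> switch_map h j ` (+) b ` l"
      "AE b in lborel. vector [2 * (b + P) $ 1, 0] \<notin> switch_map h j ` (+) b ` l"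
      by (rule AE_translate_centres_off_line)+
  next
    fix P Q j assume "j \<in> {..k - 2}"
    then have "j < h" using assms by auto
    then show "AE b in lborel. b + P \<noteq> b + Q \<longrightarrow> switch_map h j (b + Q) \<notin> switch_line k h (b + P)"
      using AE_translate_image_off_switch_line[OF assms(1) \<open>j < h\<close>, of P Q]
      by (cases "P = Q") simp_all
  qed
  moreover have "ae_filter (lborel :: (real^2) measure) \<noteq> bot"
    by (simp add: ae_filter_eq_bot_iff emeasure_lborel_UNIV)
  ultimately show ?thesis using that eventually_happens' by blast
qed

section \<open>The switch construction in generic position\<close>

text \<open>The configuration after the affine transformation, with the removed lines \<open>S\<close> and \<open>T\<close> parallel to
  the axes. The bound \<open>k - 2 < h\<close> makes all the switch maps injective. Indices range over
  \<open>{..k - 2}\<close>, where the index 0 stands for the original copy, on which \<open>switch_map h 0\<close> is the identity.\<close>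

locale placed_configuration =
  fixes k h m :: nat and X :: "(real^2) set" and L S T :: "(real^2) set set"
  assumes k3: "3 \<le> k" and h: "k - 2 < h"
    and configuration: "geometric_configuration m k X L"
    and S_subset: "S \<subseteq> L" and T_subset: "T \<subseteq> L"
    and horizontal: "l \<in> S \<Longrightarrow> affine_parallel l x_axis"
    and vertical: "l \<in> T \<Longrightarrow> affine_parallel l y_axis"
    and independent: "x \<in> X \<Longrightarrow> l \<in> S \<Longrightarrow> l' \<in> T \<Longrightarrow> x \<in> l \<Longrightarrow> x \<notin> l'"
    and generic: "generic_position k h X L"
begin

lemma finite_X: "finite X" and finite_L: "finite L" and card_X: "card X = m" and card_L: "card L = m"
  and lines: "l \<in> L \<Longrightarrow> is_line l"
  and card_lines_through: "P \<in> X \<Longrightarrow> card {l \<in> L. P \<in> l} = k"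
  and card_points_on: "l \<in> L \<Longrightarrow> card {x \<in> X. x \<in> l} = k"
  using configuration unfolding geometric_configuration_def by auto

lemma nonzero_coordinates: "P \<in> X \<Longrightarrow> P $ 1 \<noteq> 0" "P \<in> X \<Longrightarrow> P $ 2 \<noteq> 0"
  using generic by (auto simp: generic_position_def)

lemma image_notin_other_image_line:
  "P \<in> X \<Longrightarrow> l \<in> L \<Longrightarrow> i \<in> {..k - 2} \<Longrightarrow> j \<in> {..k - 2} \<Longrightarrow> i \<noteq> j \<Longrightarrow>
    switch_map h i P \<notin> switch_map h j ` l"
  and doubled_coordinate_notin_image_line:
  "P \<in> X \<Longrightarrow> l \<in> L \<Longrightarrow> j \<in> {..k - 2} \<Longrightarrow> vector [0, 2 * P $ 2] \<notin> switch_map h j ` l"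
  "P \<in> X \<Longrightarrow> l \<in> L \<Longrightarrow> j \<in> {..k - 2} \<Longrightarrow> vector [2 * P $ 1, 0] \<notin> switch_map h j ` l"
  and other_image_notin_switch_line:
  "P \<in> X \<Longrightarrow> Q \<in> X \<Longrightarrow> j \<in> {..k - 2} \<Longrightarrow> P \<noteq> Q \<Longrightarrow>
    switch_map h j Q \<notin> switch_line k h P"
  using generic unfolding generic_position_def by blast+

lemma index_less: "j \<in> {..k - 2} \<Longrightarrow> j < h"
  using h by auto

abbreviation "removed \<equiv> S \<union> T"
abbreviation "kept \<equiv> L - removed"
abbreviation "switched \<equiv> {P \<in> X. \<exists>l\<in>removed. P \<in> l}"

lemma finite_removed: "finite removed"
  using S_subset T_subset finite_L finite_subset by blast

lemma obtain_point_on: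
  assumes "l \<in> L" obtains P where "P \<in> X" "P \<in> l"
proof -
  have "{x \<in> X. x \<in> l} \<noteq> {}" using card_points_on[OF assms] k3 by (metis card.empty not_numeral_le_zero)
  then show ?thesis using that by blast
qed

lemma obtain_line_through:
  assumes "P \<in> X" obtains l where "l \<in> L" "P \<in> l"
proof -
  have "{l \<in> L. P \<in> l} \<noteq> {}" using card_lines_through[OF assms] k3 by (metis card.empty not_numeral_le_zero)
  then show ?thesis using that by blast
qed

text \<open>This is where the independence of the pencils enters: each point loses at most one line, so
  that its single switch line restores its degree.\<close>

lemma removed_line_unique:
  assumes "P \<in> X" "l \<in> removed" "l' \<in> removed" "P \<in> l" "P \<in> l'"
  shows "l = l'"
  using assms horizontal[of l] horizontal[of l'] vertical[of l] vertical[of l']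
    independent[of P l l'] independent[of P l' l]
  by (auto simp: affine_parallel_axis)

lemma mem_horizontal: "l \<in> S \<Longrightarrow> P \<in> l \<Longrightarrow> Q \<in> l \<longleftrightarrow> Q $ 2 = P $ 2"
  using horizontal[of l] by (auto simp: affine_parallel_axis)

lemma mem_vertical: "l \<in> T \<Longrightarrow> P \<in> l \<Longrightarrow> Q \<in> l \<longleftrightarrow> Q $ 1 = P $ 1"
  using vertical[of l] by (auto simp: affine_parallel_axis)

text \<open>The incidences of the result are determined by this lemma, \<open>image_mem_switch_line_iff\<close>,
  \<open>centre_mem_switch_line_iff\<close> and \<open>centre_notin_image_line\<close>. That points and lines of
  different origin are distinct is read off from these incidences.\<close>

lemma image_mem_image_iff:
  assumes "P \<in> X" "l \<in> L" "i \<in> {..k - 2}" "j \<in> {..k - 2}"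
  shows "switch_map h i P \<in> switch_map h j ` l \<longleftrightarrow> i = j \<and> P \<in> l"
  using assms image_notin_other_image_line inj_switch_map[OF index_less[OF assms(3)]]
  by (cases "i = j") (simp_all add: inj_image_mem_iff)

lemma image_eq_image_iff:
  assumes "P \<in> X" "Q \<in> X" "i \<in> {..k - 2}" "j \<in> {..k - 2}"
  shows "switch_map h i P = switch_map h j Q \<longleftrightarrow> i = j \<and> P = Q"
proof
  assume eq: "switch_map h i P = switch_map h j Q"
  obtain l where "l \<in> L" "Q \<in> l" using obtain_line_through[OF assms(2)] .
  then have "i = j" using eq image_mem_image_iff[OF assms(1) _ assms(3,4)] by auto
  then show "i = j \<and> P = Q"
    using eq inj_switch_map[OF index_less[OF assms(3)]] by (simp add: inj_eq)
qed simp

lemma mem_switch_line_iff: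
  assumes "P \<in> X"
  shows "v \<in> switch_line k h P \<longleftrightarrow> P $ 2 * v $ 1 + P $ 1 * v $ 2 = 2 * P $ 1 * P $ 2"
  using assms h k3 nonzero_coordinates by (simp add: switch_line_eq)

lemma image_mem_switch_line_iff:
  assumes "P \<in> X" "Q \<in> X" "j \<in> {..k - 2}"
  shows "switch_map h j Q \<in> switch_line k h P \<longleftrightarrow> P = Q"
proof -
  have "switch_map h j P \<in> switch_line k h P"
    using h by (simp add: mem_switch_line_iff[OF assms(1)] switch_map_component field_simps)
  then show ?thesis using assms other_image_notin_switch_line by blast
qed

lemma is_line_switch_line: "P \<in> X \<Longrightarrow> is_line (switch_line k h P)"
proof -
  assume P: "P \<in> X"
  have "switch_line k h P = {v. vector [P $ 2, P $ 1] \<bullet> v = 2 * P $ 1 * P $ 2}"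
    using mem_switch_line_iff[OF P] by (auto simp: inner_vec_def sum_2)
  moreover have "vector [P $ 2, P $ 1] \<noteq> (0 :: real^2)"
    using nonzero_coordinates[OF P] by (metis vector_2(1) zero_index)
  ultimately show ?thesis unfolding is_line_iff by blast
qed

text \<open>By \<open>centre_eq\<close> any configuration point on a removed line \<open>l\<close> gives the same value, as all of them
  agree in the coordinate that is used here.\<close>

definition centre :: "(real^2) set \<Rightarrow> real^2" where
  "centre l = (let P = SOME P. P \<in> X \<and> P \<in> l in
     if l \<in> S then vector [0, 2 * P $ 2] else vector [2 * P $ 1, 0])"

lemma centre_eq:
  assumes "P \<in> X" "P \<in> l"
  shows "l \<in> S \<Longrightarrow> centre l = vector [0, 2 * P $ 2]"
    and "l \<in> T \<Longrightarrow> centre l = vector [2 * P $ 1, 0]"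
proof -
  have some: "(SOME P. P \<in> X \<and> P \<in> l) \<in> l"
    using someI[of "\<lambda>P. P \<in> X \<and> P \<in> l"] assms by blast
  show "l \<in> S \<Longrightarrow> centre l = vector [0, 2 * P $ 2]"
    using some mem_horizontal[OF _ assms(2)] by (simp add: centre_def Let_def)
  show "l \<in> T \<Longrightarrow> centre l = vector [2 * P $ 1, 0]"
    using some mem_vertical[OF _ assms(2)] independent[OF assms(1) _ _ assms(2), of l] assms(2)
    by (auto simp add: centre_def Let_def)
qed

text \<open>For \<open>P = (x, y)\<close> on a horizontal removed line, the line \<open>X / x + Y / y = 2\<close> meets the vertical axis in
  \<open>(0, 2 y)\<close>, which depends only on the removed line. This is the concurrency that the
  construction rests on. Vertical lines are symmetric.\<close>

lemma switch_centre_eq: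
  shows "l \<in> S \<Longrightarrow> switch_centre k h X y_axis l = {centre l}"
    and "l \<in> T \<Longrightarrow> switch_centre k h X x_axis l = {centre l}"
proof -
  show "switch_centre k h X y_axis l = {centre l}" if l: "l \<in> S"
  proof -
    obtain P where P: "P \<in> X" "P \<in> l" using l S_subset obtain_point_on by blast
    have on: "(\<forall>Q\<in>X \<inter> l. c \<in> switch_line k h Q) \<longleftrightarrow> c $ 2 = 2 * P $ 2" if "c \<in> y_axis" for c
      using that P l nonzero_coordinates mem_horizontal[OF l P(2)]
      by (auto simp: mem_switch_line_iff y_axis_def)
    have "c \<in> y_axis \<and> (\<forall>Q\<in>X \<inter> l. c \<in> switch_line k h Q) \<longleftrightarrow> c = vector [0, 2 * P $ 2]" for c
      using on[of c] by (auto simp: y_axis_def vec_eq_iff forall_2)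
    then show ?thesis
      unfolding switch_centre_def centre_eq(1)[OF P l] by simp
  qed
  show "switch_centre k h X x_axis l = {centre l}" if l: "l \<in> T"
  proof -
    obtain P where P: "P \<in> X" "P \<in> l" using l T_subset obtain_point_on by blast
    have on: "(\<forall>Q\<in>X \<inter> l. c \<in> switch_line k h Q) \<longleftrightarrow> c $ 1 = 2 * P $ 1" if "c \<in> x_axis" for c
      using that P l nonzero_coordinates mem_vertical[OF l P(2)]
      by (auto simp: mem_switch_line_iff x_axis_def)
    have "c \<in> x_axis \<and> (\<forall>Q\<in>X \<inter> l. c \<in> switch_line k h Q) \<longleftrightarrow> c = vector [2 * P $ 1, 0]" for c
      using on[of c] by (auto simp: x_axis_def vec_eq_iff forall_2)
    then show ?thesis
      unfolding switch_centre_def centre_eq(2)[OF P l] by simp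
  qed
qed

text \<open>Nonzero coordinates suffice for this: \<open>(0, 2 c)\<close> lies on \<open>X / x + Y / y = 2\<close>
  exactly if \<open>c = y\<close>.\<close>

lemma centre_mem_switch_line_iff:
  assumes "P \<in> X" "l \<in> removed"
  shows "centre l \<in> switch_line k h P \<longleftrightarrow> P \<in> l"
proof -
  obtain Q where Q: "Q \<in> X" "Q \<in> l" using assms S_subset T_subset obtain_point_on by blast
  show ?thesis
    using assms(2) nonzero_coordinates[OF assms(1)] mem_horizontal[OF _ Q(2), of P] mem_vertical[OF _ Q(2), of P]
    by (auto simp: mem_switch_line_iff[OF assms(1)] centre_eq[OF Q])
qed

lemma inj_on_centre: "inj_on centre removed"
proof (rule inj_onI)
  fix l l' assume l: "l \<in> removed" "l' \<in> removed" "centre l = centre l'"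
  obtain P where P: "P \<in> X" "P \<in> l" using l S_subset T_subset obtain_point_on by blast
  then have "P \<in> l'" using l centre_mem_switch_line_iff by metis
  then show "l = l'" using l P removed_line_unique by blast
qed

lemma centre_notin_image_line:
  assumes "l \<in> removed" "l' \<in> L" "j \<in> {..k - 2}"
  shows "centre l \<notin> switch_map h j ` l'"
proof -
  obtain P where P: "P \<in> X" "P \<in> l" using assms S_subset T_subset obtain_point_on by blast
  show ?thesis
    using assms P(1) doubled_coordinate_notin_image_line
    by (cases "l \<in> S") (simp_all add: centre_eq[OF P])
qed

lemma centre_neq_image:
  assumes "l \<in> removed" "P \<in> X" "j \<in> {..k - 2}"
  shows "centre l \<noteq> switch_map h j P"
  using centre_notin_image_line[OF assms(1) _ assms(3)] obtain_line_through[OF assms(2)] by blast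

lemma image_line_eq_image_line:
  assumes "l \<in> L" "l' \<in> L" "i \<in> {..k - 2}" "j \<in> {..k - 2}" "switch_map h i ` l = switch_map h j ` l'"
  shows "i = j \<and> l = l'"
proof -
  obtain P where "P \<in> X" "P \<in> l" using assms obtain_point_on by blast
  then have "i = j" using assms image_mem_image_iff by blast
  then show ?thesis using assms inj_switch_map[OF index_less[OF assms(3)]]
    by (simp add: inj_image_eq_iff)
qed

text \<open>A switch line contains points of at least two different copies, whereas the image of a
  line contains configuration points of one copy only.\<close>

lemma switch_line_neq_image_line:
  assumes "P \<in> X" "l \<in> L" "j \<in> {..k - 2}"
  shows "switch_line k h P \<noteq> switch_map h j ` l"
proof
  assume "switch_line k h P = switch_map h j ` l"
  then have "switch_map h i P \<in> switch_map h j ` l" if "i \<in> {..k - 2}" for i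
    using image_mem_switch_line_iff assms that by blast
  then have "i = j" if "i \<in> {..k - 2}" for i
    using image_mem_image_iff[OF assms(1,2) _ assms(3)] that by blast
  from this[of 0] this[of 1] show False using k3 by auto
qed

lemma inj_on_switch_line: "inj_on (switch_line k h) X"
  by (rule inj_onI) (metis atMost_iff image_mem_switch_line_iff le0)

section \<open>Counting incidences\<close>

lemma switch_points_eq:
  "switch_points k h X S T =
     (\<lambda>(j, P). switch_map h j P) ` ({..k - 2} \<times> X) \<union> centre ` removed"
proof -
  have J: "{..k - 2} = insert 0 {1..k - 2}" by auto
  have id: "switch_map h 0 v = v" for v using h by (simp add: switch_map_0)
  show ?thesis
    unfolding switch_points_def J by (auto simp: switch_centre_eq id image_iff)
qed

lemma switch_lines_eq:
  "switch_lines k h X L S T =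
     (\<lambda>(j, l). switch_map h j ` l) ` ({..k - 2} \<times> kept) \<union> switch_line k h ` switched"
proof -
  have J: "{..k - 2} = insert 0 {1..k - 2}" by auto
  have id: "switch_map h 0 ` l = l" for l using h by (simp add: switch_map_0)
  have "(\<lambda>(j, l). switch_map h j ` l) ` ({..k - 2} \<times> kept) =
     (\<Union>j\<in>{..k - 2}. (\<lambda>l. switch_map h j ` l) ` kept)"
    by fastforce
  then show ?thesis
    unfolding switch_lines_def J by (simp add: id)
qed

lemma switch_points_cases:
  assumes "x \<in> switch_points k h X S T"
  obtains (image) j P where "j \<in> {..k - 2}" "P \<in> X" "x = switch_map h j P"
    | (centre) l where "l \<in> removed" "x = centre l"
  using assms unfolding switch_points_eq by (elim UnE imageE SigmaE) auto

lemma switch_lines_cases: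
  assumes "l \<in> switch_lines k h X L S T"
  obtains (image) j l' where "j \<in> {..k - 2}" "l' \<in> kept" "l = switch_map h j ` l'"
    | (switch) P where "P \<in> switched" "l = switch_line k h P"
  using assms unfolding switch_lines_eq by (elim UnE imageE SigmaE) auto

lemma card_switch_points: "card (switch_points k h X S T) = (k - 1) * m + card removed"
proof -
  have "card (switch_points k h X S T) =
     card ((\<lambda>(j, P). switch_map h j P) ` ({..k - 2} \<times> X)) + card (centre ` removed)"
    unfolding switch_points_eq
    using finite_X finite_removed centre_neq_image by (intro card_Un_disjoint) (auto, metis+)
  moreover have "inj_on (\<lambda>(j, P). switch_map h j P) ({..k - 2} \<times> X)"
    using image_eq_image_iff by (auto simp: inj_on_def)
  moreover have "Suc (k - 2) = k - 1" using k3 by simp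
  ultimately show ?thesis
    using inj_on_centre by (simp add: card_image card_cartesian_product card_X)
qed

lemma card_switched: "card switched = card removed * k"
proof -
  have "switched = (\<Union>l\<in>removed. {x \<in> X. x \<in> l})" by auto
  also have "card \<dots> = (\<Sum>l\<in>removed. card {x \<in> X. x \<in> l})"
    using finite_removed finite_X removed_line_unique by (intro card_UN_disjoint) auto
  also have "\<dots> = (\<Sum>l\<in>removed. k)"
    using S_subset T_subset card_points_on by (intro sum.cong) auto
  finally show ?thesis by simp
qed

text \<open>Of the \<open>(k - 1) m\<close> image lines, \<open>k - 1\<close> are missing for each removed line, while the \<open>k\<close> points
  of that line contribute a switch line each, a net gain of one.\<close>

lemma card_switch_lines: "card (switch_lines k h X L S T) = (k - 1) * m + card removed"
proof -
  have "card (switch_lines k h X L S T) =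
     card ((\<lambda>(j, l). switch_map h j ` l) ` ({..k - 2} \<times> kept)) + card (switch_line k h ` switched)"
    unfolding switch_lines_eq
    using finite_X finite_L switch_line_neq_image_line
    by (intro card_Un_disjoint) (auto, metis+)
  moreover have "inj_on (\<lambda>(j, l). switch_map h j ` l) ({..k - 2} \<times> kept)"
    by (rule inj_onI, clarify) (metis Diff_iff atMost_iff image_line_eq_image_line)
  moreover have "inj_on (switch_line k h) switched"
    by (rule inj_on_subset[OF inj_on_switch_line]) auto
  moreover have "card kept = m - card removed" "card removed \<le> m"
    using S_subset T_subset finite_removed finite_L card_L card_mono[of L removed]
    by (auto simp: card_Diff_subset)
  moreover have "(k - 1) * (m - card removed) + card removed * k = (k - 1) * m + card removed"
    if "card removed \<le> m"
  proof -
    obtain n where "m = card removed + n" using \<open>card removed \<le> m\<close> le_Suc_ex by blast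
    moreover obtain k' where "k = Suc k'" using k3 by (cases k) auto
    ultimately show ?thesis by (simp add: algebra_simps)
  qed
  moreover have "Suc (k - 2) = k - 1" using k3 by simp
  ultimately show ?thesis
    by (simp add: card_image card_cartesian_product card_switched)
qed

text \<open>The kept lines through \<open>P\<close> number \<open>k\<close>, or \<open>k - 1\<close> if a line through \<open>P\<close> was removed; in exactly
  the second case the switch line of \<open>P\<close> is added.\<close>

lemma card_switch_lines_through_image:
  assumes "P \<in> X" "j \<in> {..k - 2}"
  shows "card {l \<in> switch_lines k h X L S T. switch_map h j P \<in> l} = k"
proof -
  have "{l \<in> switch_lines k h X L S T. switch_map h j P \<in> l} =
     (`) (switch_map h j) ` {l \<in> kept. P \<in> l} \<union> switch_line k h ` {Q \<in> switched. Q = P}" (is "?A = ?B")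
  proof (intro subset_antisym subsetI)
    fix l assume "l \<in> ?A"
    then have P: "switch_map h j P \<in> l" and "l \<in> switch_lines k h X L S T" by blast+
    from this(2) show "l \<in> ?B"
    proof (cases rule: switch_lines_cases)
      case (image i l')
      then show ?thesis using P image_mem_image_iff[OF assms(1) _ assms(2) image(1)] by blast
    next
      case (switch Q)
      then show ?thesis using P image_mem_switch_line_iff[OF _ assms] by blast
    qed
  next
    fix l assume "l \<in> ?B"
    then consider l' where "l' \<in> kept" "P \<in> l'" "l = switch_map h j ` l'"
      | "P \<in> switched" "l = switch_line k h P" by blast
    then show "l \<in> ?A"
      by cases (use assms image_mem_switch_line_iff[OF assms(1) assms] in \<open>auto simp: switch_lines_eq\<close>)
  qed
  also have "card \<dots> = card ((`) (switch_map h j) ` {l \<in> kept. P \<in> l}) + card (switch_line k h ` {Q \<in> switched. Q = P})"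
    using finite_L finite_X assms switch_line_neq_image_line by (intro card_Un_disjoint) (auto, metis+)
  also have "card ((`) (switch_map h j) ` {l \<in> kept. P \<in> l}) = card {l \<in> kept. P \<in> l}"
    using image_line_eq_image_line assms by (intro card_image inj_onI) auto
  also have "card (switch_line k h ` {Q \<in> switched. Q = P}) = card {l \<in> removed. P \<in> l}"
  proof (cases "P \<in> switched")
    case True
    then obtain l where "l \<in> removed" "P \<in> l" by blast
    then have "{l \<in> removed. P \<in> l} = {l}" using removed_line_unique assms by blast
    moreover have "{Q \<in> switched. Q = P} = {P}" using True by blast
    ultimately show ?thesis by simp
  next
    case False
    then have "{l \<in> removed. P \<in> l} = {}" "{Q \<in> switched. Q = P} = {}" using assms by auto
    then show ?thesis by (simp only: image_empty)
  qed
  also have "card {l \<in> kept. P \<in> l} + card {l \<in> removed. P \<in> l} =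
      card ({l \<in> kept. P \<in> l} \<union> {l \<in> removed. P \<in> l})"
    using finite_L finite_removed by (intro card_Un_disjoint[symmetric]) auto
  also have "{l \<in> kept. P \<in> l} \<union> {l \<in> removed. P \<in> l} = {l \<in> L. P \<in> l}"
    using S_subset T_subset by blast
  finally show ?thesis using card_lines_through[OF assms(1)] by simp
qed

lemma card_switch_lines_through_centre:
  assumes "l \<in> removed"
  shows "card {l' \<in> switch_lines k h X L S T. centre l \<in> l'} = k"
proof -
  have "{l' \<in> switch_lines k h X L S T. centre l \<in> l'} = switch_line k h ` {x \<in> X. x \<in> l}" (is "?A = ?B")
  proof (intro subset_antisym subsetI)
    fix l' assume "l' \<in> ?A"
    then have c: "centre l \<in> l'" and "l' \<in> switch_lines k h X L S T" by blast+
    from this(2) show "l' \<in> ?B"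
    proof (cases rule: switch_lines_cases)
      case (image i l'')
      then show ?thesis using c centre_notin_image_line[OF assms] by blast
    next
      case (switch Q)
      then show ?thesis using c centre_mem_switch_line_iff[OF _ assms] by blast
    qed
  next
    fix l' assume "l' \<in> ?B"
    then show "l' \<in> ?A"
      using assms centre_mem_switch_line_iff[OF _ assms] unfolding switch_lines_eq by blast
  qed
  also have "card \<dots> = card {x \<in> X. x \<in> l}"
    by (intro card_image inj_on_subset[OF inj_on_switch_line]) auto
  finally show ?thesis using assms S_subset T_subset card_points_on by auto
qed

lemma card_switch_points_on_image_line:
  assumes "l \<in> kept" "j \<in> {..k - 2}"
  shows "card {x \<in> switch_points k h X S T. x \<in> switch_map h j ` l} = k"
proof -
  have l: "l \<in> L" using assms(1) by blast
  have "{x \<in> switch_points k h X S T. x \<in> switch_map h j ` l} = switch_map h j ` {x \<in> X. x \<in> l}"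
  proof (intro subset_antisym subsetI)
    fix x assume "x \<in> {x \<in> switch_points k h X S T. x \<in> switch_map h j ` l}"
    then have x: "x \<in> switch_map h j ` l" and "x \<in> switch_points k h X S T" by blast+
    from this(2) show "x \<in> switch_map h j ` {x \<in> X. x \<in> l}"
    proof (cases rule: switch_points_cases)
      case (image i P)
      then show ?thesis using x image_mem_image_iff[OF _ l _ assms(2)] by blast
    next
      case (centre l')
      then show ?thesis using x centre_notin_image_line[OF _ l assms(2)] by blast
    qed
  qed (use assms(2) in \<open>auto simp: switch_points_eq\<close>)
  also have "card \<dots> = card {x \<in> X. x \<in> l}"
    by (rule card_image[OF inj_on_subset[OF inj_switch_map[OF index_less[OF assms(2)]] subset_UNIV]])
  finally show ?thesis using assms card_points_on by auto
qed

lemma card_switch_points_on_switch_line: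
  assumes "P \<in> switched"
  shows "card {x \<in> switch_points k h X S T. x \<in> switch_line k h P} = k"
proof -
  obtain l where l: "l \<in> removed" "P \<in> l" and P: "P \<in> X" using assms by blast
  have "{x \<in> switch_points k h X S T. x \<in> switch_line k h P} =
     insert (centre l) ((\<lambda>j. switch_map h j P) ` {..k - 2})" (is "?A = ?B")
  proof (intro subset_antisym subsetI)
    fix x assume "x \<in> ?A"
    then have x: "x \<in> switch_line k h P" and "x \<in> switch_points k h X S T" by blast+
    from this(2) show "x \<in> ?B"
    proof (cases rule: switch_points_cases)
      case (image j Q)
      then show ?thesis using x image_mem_switch_line_iff[OF P] by blast
    next
      case (centre l')
      then show ?thesis using x removed_line_unique[OF P] centre_mem_switch_line_iff[OF P] l by blast
    qed
  next
    fix x assume "x \<in> ?B"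
    then show "x \<in> ?A"
      unfolding switch_points_eq
      using l P image_mem_switch_line_iff[OF P P] centre_mem_switch_line_iff[OF P l(1)] by auto
  qed
  also have "card \<dots> = Suc (card ((\<lambda>j. switch_map h j P) ` {..k - 2}))"
    using centre_neq_image[OF l(1) P] by (intro card_insert_disjoint) auto
  also have "card ((\<lambda>j. switch_map h j P) ` {..k - 2}) = card {..k - 2}"
    using image_eq_image_iff[OF P P] by (intro card_image inj_onI) auto
  finally show ?thesis using k3 by simp
qed

theorem geometric_configuration_switch:
  "geometric_configuration ((k - 1) * m + card removed) k
     (switch_points k h X S T) (switch_lines k h X L S T)"
proof -
  have "finite (switch_points k h X S T)" "finite (switch_lines k h X L S T)"
    unfolding switch_points_eq switch_lines_eq using finite_X finite_L finite_removed by auto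
  moreover have "is_line l" if "l \<in> switch_lines k h X L S T" for l
    using that lines is_line_switch_line
      is_line_injective_linear_image[OF linear_switch_map inj_switch_map[OF index_less]]
    unfolding switch_lines_eq by auto
  moreover have "card {l \<in> switch_lines k h X L S T. x \<in> l} = k" if "x \<in> switch_points k h X S T" for x
    using that by (cases rule: switch_points_cases)
      (simp_all only: card_switch_lines_through_image card_switch_lines_through_centre)
  moreover have "card {x \<in> switch_points k h X S T. x \<in> l} = k" if "l \<in> switch_lines k h X L S T" for l
    using that by (cases rule: switch_lines_cases)
      (simp_all only: card_switch_points_on_image_line card_switch_points_on_switch_line)
  ultimately show ?thesis
    unfolding geometric_configuration_def using card_switch_points card_switch_lines by blast
qed

end

section \<open>Placing the pencils parallel to the axes\<close>

lemma geometric_configuration_image: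
  assumes conf: "geometric_configuration m k X L" and f: "inj f"
    and lines: "\<And>l. is_line l \<Longrightarrow> is_line (f ` l)"
  shows "geometric_configuration m k (f ` X) ((`) f ` L)"
proof -
  have inj: "inj_on f B" "inj_on ((`) f) M" for B M
    using f by (auto simp: inj_on_def inj_image_eq_iff)
  have "{l \<in> (`) f ` L. f x \<in> l} = (`) f ` {l \<in> L. x \<in> l}" for x
    by (auto simp: inj_eq[OF f])
  moreover have "{x \<in> f ` X. x \<in> f ` l} = f ` {x \<in> X. x \<in> l}" for l
    by (auto simp: inj_eq[OF f])
  ultimately show ?thesis
    using conf lines unfolding geometric_configuration_def
    by (simp add: card_image inj)
qed

lemma parallel_lines_common_normal:
  assumes "pairwise affine_parallel F" "\<And>l. l \<in> F \<Longrightarrow> is_line l" "F \<noteq> {}"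
  obtains n where "n \<noteq> 0" "\<And>l. l \<in> F \<Longrightarrow> \<exists>c. l = {v. n \<bullet> v = c}"
proof -
  obtain l0 n c where l0: "l0 \<in> F" and n: "n \<noteq> 0" "l0 = {v. n \<bullet> v = c}"
    using assms(2,3) is_line_iff by blast
  have "\<exists>c. l = {v. n \<bullet> v = c}" if "l \<in> F" for l
    using that assms(1) l0 n affine_parallel_hyperplane[OF n(1), of c l]
    by (cases "l = l0") (auto simp: pairwise_def)
  then show ?thesis using that n(1) by blast
qed

text \<open>The matrix whose rows are the common normals of \<open>QQ\<close> and \<open>PP\<close> sends a line \<open>n \<bullet> v = c\<close> to one on
  which a coordinate has the constant value \<open>c\<close>. It is invertible because proportional normals
  would make a line of \<open>PP\<close> parallel to one of \<open>QQ\<close>. If \<open>PP\<close> is empty, any second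
  direction serves, for example the perpendicular one.\<close>

lemma exists_axis_alignment:
  assumes PP: "pairwise affine_parallel PP" "\<And>l. l \<in> PP \<Longrightarrow> is_line l"
    and QQ: "pairwise affine_parallel QQ" "\<And>l. l \<in> QQ \<Longrightarrow> is_line l" "QQ \<noteq> {}"
    and not_parallel: "\<And>l l'. l \<in> PP \<Longrightarrow> l' \<in> QQ \<Longrightarrow> \<not> affine_parallel l l'"
  obtains A :: "real^2^2" where "invertible A"
    "\<And>l. l \<in> PP \<Longrightarrow> affine_parallel ((*v) A ` l) x_axis"
    "\<And>l. l \<in> QQ \<Longrightarrow> affine_parallel ((*v) A ` l) y_axis"
proof -
  obtain n where n: "n \<noteq> 0" "\<And>l. l \<in> QQ \<Longrightarrow> \<exists>c. l = {v. n \<bullet> v = c}"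
    using parallel_lines_common_normal[OF QQ] by blast
  have n': "n $ 1 \<noteq> 0 \<or> n $ 2 \<noteq> 0" using n(1) vec2_eqI[of n 0] by auto
  obtain n1 where n1: "\<And>l. l \<in> PP \<Longrightarrow> \<exists>c. l = {v. n1 \<bullet> v = c}"
    and indep: "n $ 1 * n1 $ 2 \<noteq> n $ 2 * n1 $ 1"
  proof (cases "PP = {}")
    case True
    have "n $ 1 * n $ 1 + n $ 2 * n $ 2 \<noteq> 0" using n' by (simp add: sum_squares_eq_zero_iff)
    then show ?thesis using True that[of "vector [- n $ 2, n $ 1]"] by (simp add: add_eq_0_iff)
  next
    case False
    then obtain n1 where n1: "n1 \<noteq> 0" "\<And>l. l \<in> PP \<Longrightarrow> \<exists>c. l = {v. n1 \<bullet> v = c}"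
      using parallel_lines_common_normal[OF PP] by blast
    have "n $ 1 * n1 $ 2 \<noteq> n $ 2 * n1 $ 1"
    proof
      assume eq: "n $ 1 * n1 $ 2 = n $ 2 * n1 $ 1"
      define t where "t = (if n $ 1 \<noteq> 0 then n1 $ 1 / n $ 1 else n1 $ 2 / n $ 2)"
      have t: "n1 = t *\<^sub>R n"
        using eq n' by (intro vec2_eqI) (auto simp: t_def field_simps)
      then have "t \<noteq> 0" using n1(1) by auto
      obtain l l' where l: "l \<in> PP" "l' \<in> QQ" using False QQ(3) by blast
      obtain c c' where c: "l = {v. n1 \<bullet> v = c}" "l' = {v. n \<bullet> v = c'}"
        using n1(2) n(2) l by meson
      have "l = {v. n \<bullet> v = c / t}"
        using \<open>t \<noteq> 0\<close> unfolding c t by (auto simp: field_simps)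
      then have "affine_parallel l l'"
        using affine_parallel_hyperplane[OF n(1)] c(2) by blast
      then show False using not_parallel l by blast
    qed
    then show ?thesis using that n1(2) by blast
  qed
  define A :: "real^2^2" where "A = vector [n, n1]"
  have A: "(A *v v) $ 1 = n \<bullet> v" "(A *v v) $ 2 = n1 \<bullet> v" for v
    by (simp_all add: A_def matrix_vector_mult_def inner_vec_def sum_2)
  have "det A \<noteq> 0" using indep by (simp add: det_2 A_def)
  then have inv: "invertible A" by (simp add: invertible_det_nz)
  then have surj: "\<exists>v. w = A *v v" for w
    unfolding invertible_def by (metis matrix_vector_mul_assoc matrix_vector_mul_lid)
  have "affine_parallel ((*v) A ` l) x_axis" if "l \<in> PP" for l
  proof -
    obtain c where "l = {v. n1 \<bullet> v = c}" using n1 \<open>l \<in> PP\<close> by blast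
    then have "(*v) A ` l = {w. w $ 2 = c}" using surj A by (auto simp: image_iff) metis
    then show ?thesis by (auto simp: affine_parallel_axis)
  qed
  moreover have "affine_parallel ((*v) A ` l) y_axis" if "l \<in> QQ" for l
  proof -
    obtain c where "l = {v. n \<bullet> v = c}" using n \<open>l \<in> QQ\<close> by blast
    then have "(*v) A ` l = {w. w $ 1 = c}" using surj A by (auto simp: image_iff) metis
    then show ?thesis by (auto simp: affine_parallel_axis)
  qed
  ultimately show ?thesis using that inv by blast
qed

section \<open>The affine switch\<close>

theorem lemma8:
  fixes k m p q r :: nat
    and X :: "(real^2) set"
    and L PP QQ :: "(real^2) set set"
  assumes "3 \<le> k"
    and "geometric_configuration m k X L"
    and "independent_pencils X L p q PP QQ"
    and "1 \<le> q"
    and "1 \<le> r" and "r \<le> p + q"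
  shows "\<exists>X' L'. affine_switch k r X L PP QQ X' L' \<and>
           geometric_configuration ((k - 1) * m + r) k X' L'"
proof -
  have fin: "finite X" "finite L" and lines: "\<And>l. l \<in> L \<Longrightarrow> is_line l"
    using assms(2) by (auto simp: geometric_configuration_def)
  have PP: "PP \<subseteq> L" "card PP = p" "pairwise affine_parallel PP"
    and QQ: "QQ \<subseteq> L" "card QQ = q" "pairwise affine_parallel QQ"
    and np: "\<And>l l'. l \<in> PP \<Longrightarrow> l' \<in> QQ \<Longrightarrow> \<not> affine_parallel l l'"
    and indep: "\<And>x l l'. x \<in> X \<Longrightarrow> l \<in> PP \<Longrightarrow> l' \<in> QQ \<Longrightarrow> x \<in> l \<Longrightarrow> x \<notin> l'"
    using assms(3) unfolding independent_pencils_def by blast+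
  have "QQ \<noteq> {}" using QQ(2) assms(4) by auto
  then obtain A :: "real^2^2" where A: "invertible A"
    "\<And>l. l \<in> PP \<Longrightarrow> affine_parallel ((*v) A ` l) x_axis"
    "\<And>l. l \<in> QQ \<Longrightarrow> affine_parallel ((*v) A ` l) y_axis"
    using exists_axis_alignment[OF PP(3) _ QQ(3) _ _ np] PP(1) QQ(1) lines by blast
  have inj_A: "inj ((*v) A)" using A(1) by (simp add: inj_matrix_vector_mult)
  have A_line: "is_line ((*v) A ` l)" if "is_line l" for l
    using that inj_A by (intro is_line_injective_linear_image) simp_all
  \<comment> \<open>the least value for which all the switch maps are injective\<close>
  define h where "h = k - 1"
  have h: "k - 2 < h" "0 < h" using assms(1) by (auto simp: h_def)
  obtain b where b: "generic_position k h ((+) b ` (*v) A ` X) ((`) ((+) b) ` (`) ((*v) A) ` L)"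
    using exists_generic_translation[OF assms(1) h(1), of "(*v) A ` X" "(`) ((*v) A) ` L"]
      fin lines A_line by blast
  define f where "f = (\<lambda>v. A *v v + b)"
  have f: "f ` B = (+) b ` (*v) A ` B" for B
    by (auto simp: f_def image_image add.commute)
  have gen: "generic_position k h (f ` X) ((`) f ` L)"
    using b by (simp add: f image_image)
  have inj_f: "inj f" using inj_A by (auto simp: f_def inj_def)
  have shift: "affine_parallel (f ` l) ax" if "affine_parallel ((*v) A ` l) ax" for l ax
  proof -
    have "affine_parallel ((*v) A ` l) (f ` l)" unfolding affine_parallel_def f by blast
    then show ?thesis using that affine_parallel_assoc affine_parallel_commute by blast
  qed
  have conf: "geometric_configuration m k (f ` X) ((`) f ` L)"
    using assms(2) inj_f
    by (rule geometric_configuration_image) (simp add: f is_line_translation A_line)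
  obtain S where S: "S \<subseteq> PP" "card S = min r p"
    using obtain_subset_with_card_n[of "min r p" PP] PP(2) by auto
  have "r - min r p \<le> card QQ" using QQ(2) assms(6) by simp
  then obtain T where T: "T \<subseteq> QQ" "card T = r - min r p"
    using obtain_subset_with_card_n by metis
  have ST: "card S + card T = r" using S T by simp
  interpret placed: placed_configuration k h m "f ` X" "(`) f ` L" "(`) f ` S" "(`) f ` T"
  proof
    show "(`) f ` S \<subseteq> (`) f ` L" "(`) f ` T \<subseteq> (`) f ` L"
      using S(1) T(1) PP(1) QQ(1) by blast+
    show "affine_parallel l x_axis" if "l \<in> (`) f ` S" for l
      using that S(1) A(2) shift by blast
    show "affine_parallel l y_axis" if "l \<in> (`) f ` T" for l
      using that T(1) A(3) shift by blast
    show "x \<notin> l'" if "x \<in> f ` X" "l \<in> (`) f ` S" "l' \<in> (`) f ` T" "x \<in> l" for x l l'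
      using that S(1) T(1) indep by (auto simp: inj_eq[OF inj_f]) blast
  qed (use assms(1) h conf gen in auto)
  have "S \<inter> T = {}"
    using S(1) T(1) np affine_parallel_reflex by blast
  moreover have "finite S" "finite T"
    using S(1) T(1) PP(1) QQ(1) fin(2) by (meson finite_subset)+
  moreover have "(`) f ` S \<union> (`) f ` T = (`) f ` (S \<union> T)" by blast
  moreover have "inj_on ((`) f) (S \<union> T)"
    using inj_f by (auto simp: inj_on_def inj_image_eq_iff)
  ultimately have "card ((`) f ` S \<union> (`) f ` T) = r"
    using ST by (simp add: card_image card_Un_disjoint)
  then have "geometric_configuration ((k - 1) * m + r) k
     (switch_points k h (f ` X) ((`) f ` S) ((`) f ` T))
     (switch_lines k h (f ` X) ((`) f ` L) ((`) f ` S) ((`) f ` T))"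
    using placed.geometric_configuration_switch by simp
  moreover have "affine_transformation f"
    unfolding affine_transformation_def f_def using A(1) by blast
  then have "affine_switch k r X L PP QQ (switch_points k h (f ` X) ((`) f ` S) ((`) f ` T))
     (switch_lines k h (f ` X) ((`) f ` L) ((`) f ` S) ((`) f ` T))"
    unfolding affine_switch_def using A(2,3) shift S(1) T(1) ST h(2) by blast
  ultimately show ?thesis by blast
qed

end
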